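(* For every integer $n\ge 2$ and every real number $\varepsilon>0$, there exist velocity functions $\nu_1,\dots,\nu_n$ of $n$ innocent runners on the unit circle $\mathbb{R}/\mathbb{Z}$ such that, if all runners start at the same point at time $0$, then at every time $s>0$ the slowest runner (runner $1$) is at a distance less than $2^{-n+1}+\varepsilon$ from another runner. That is, for every $s>0$ there exists $j\in\{2,\dots,n\}$ with $$\left\|\int_0^s \bigl(\nu_j(t)-\nu_1(t)\bigr)\,dt\right\|_{\mathbb{R}/\mathbb{Z}} < 2^{-n+1}+\varepsilon.$$
   Context: For $x\in\mathbb{R}$, $\|x\|_{\mathbb{R}/\mathbb{Z}}$ denotes the distance from $x$ to the nearest integer. Runners are indexed by $\{1,\dots,n\}$, and runner $i$ has a velocity function $\nu_i\in L^1_{\mathrm{loc}}(\mathbb{R}_{>0})$, where local integrability includes integrability near $0$, i.e. $\int_0^s|\nu_i(t)|\,dt<\infty$ for every $s>0$. When all runners start at the same point, the position of runner $i$ at time $s$ is $\int_0^s\nu_i(t)\,dt$ modulo $1$ (up to a common translation), and the distance between runners $i$ and $j$ at time $s$ is $\left\|\int_0^s(\nu_j(t)-\nu_i(t))\,dt\right\|_{\mathbb{R}/\mathbb{Z}}$. The $n$ runners are called innocent if (i) $\nu_1<\nu_2<\cdots<\nu_n$ almost everywhere on $\mathbb{R}_{>0}$, and (ii) for every $1\le i<j\le n$, $\int_0^\infty(\nu_j(t)-\nu_i(t))\,dt=\infty$. *)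

theory Defs
  imports "HOL-Analysis.Analysis"
begin

text \<open>Distance from a real number to the nearest integer, i.e. the norm on \<open>\<real>/\<int>\<close>.\<close>

definition norm_RZ :: "real \<Rightarrow> real" where
  "norm_RZ x = infdist x \<int>"

text \<open>
  Velocity functions are represented by total functions; the values at times \<open>t \<le> 0\<close> are
  irrelevant. Local integrability includes integrability near \<open>0\<close>.
\<close>

definition velocity_function :: "(real \<Rightarrow> real) \<Rightarrow> bool" where
  "velocity_function v \<longleftrightarrow> (\<forall>s>0. set_integrable lebesgue {0<..s} v)"

definition rel_displacement :: "(real \<Rightarrow> real) \<Rightarrow> (real \<Rightarrow> real) \<Rightarrow> real \<Rightarrow> real" where
  "rel_displacement v w s = (LINT t:{0<..s}|lebesgue. w t - v t)"

text \<open>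
  The Bochner integral of a non-integrable function is \<open>0\<close>, so the condition that the integral
  of \<open>\<nu> j - \<nu> i\<close> over \<open>(0,\<infinity>)\<close> is infinite is expressed as divergence to infinity of the
  integrals over \<open>(0,s]\<close>. The integrand is positive almost everywhere, so this improper integral
  agrees with the Lebesgue one.
\<close>

definition innocent_runners :: "nat \<Rightarrow> (nat \<Rightarrow> real \<Rightarrow> real) \<Rightarrow> bool" where
  "innocent_runners n \<nu> \<longleftrightarrow>
     (\<forall>i\<in>{1..n}. velocity_function (\<nu> i)) \<and>
     (AE t\<in>{0<..} in lebesgue. strict_mono_on {1..n} (\<lambda>i. \<nu> i t)) \<and>
     (\<forall>i\<in>{1..n}. \<forall>j\<in>{1..n}. i < j \<longrightarrow>
        filterlim (rel_displacement (\<nu> i) (\<nu> j)) at_top at_top)"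

end

theory Submission
  imports Defs
begin

text \<open>
  Work in the frame of runner \<open>1\<close>, which then stands still, and let \<open>K = 2^(n-2)\<close>. Suppose first
  that the other runners all move at speed \<open>1/K\<close>. Around an integer time \<open>k\<close>, a runner that is at
  an integer position at time \<open>k\<close> is within \<open>1/(2K) = 2^(1-n)\<close> of runner \<open>1\<close> during the whole unit
  interval centred at \<open>k\<close>; say that it covers the slot \<open>k\<close>. The slots are distributed among the
  runners by the ruler sequence: runner \<open>n\<close> covers the odd \<open>k\<close>, runner \<open>n - 1\<close> the \<open>k\<close> that are
  \<open>2\<close> modulo \<open>4\<close>, and so on up to runner \<open>3\<close>, and runner \<open>2\<close> covers all multiples of \<open>K\<close>.

  The slots of runner \<open>i \<ge> 3\<close> are spaced by \<open>P = 2^(n+1-i)\<close>, and halfway between two of them there is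
  a slot covered by a slower runner. While that runner covers, all faster ones are free to
  rush ahead, so runner \<open>i\<close> can use this moment to make the extra gain, congruent to \<open>-P/K\<close>
  modulo \<open>1\<close>, that brings it back to an integer at its next slot. Gains can be
  enlarged by arbitrary integers, so they can be chosen increasing in \<open>i\<close>; and the times at which a
  runner rushes are among those at which any faster one does. Hence the order of the
  velocities is respected. It is made strict by a slow drift: a small fraction \<open>a\<close> of each gain is
  spread evenly over the period. As the total gain per period is unchanged, the errors do not
  accumulate and cost at most \<open>a * n\<close>, which is below \<open>\<epsilon>\<close> for small \<open>a\<close>. One additional rush at
  the very beginning, while runner \<open>2\<close> covers slot \<open>0\<close>, sets the right phases.

  The order of the velocities is lemma \<open>velocity_gap\<close>, whose uniform gap also gives the divergence
  of the displacements; the covering is \<open>runner_two_close\<close> and \<open>runner_close\<close>, and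
  \<open>dvd_power_two_or_odd_multiple\<close> assigns the slots.
\<close>

section \<open>Periodic bursts\<close>

text \<open>
  A burst lasts half a unit of time, so it stays inside the slot centred at its
  starting point.
\<close>

definition bursts :: "nat \<Rightarrow> real set" where
  "bursts P = (\<Union>q. {real q * real P<..real q * real P + 1/2})"

lemma bursts_antimono:
  assumes "P dvd Q"
  shows "bursts Q \<subseteq> bursts P"
proof -
  obtain c where "Q = P * c" using assms by blast
  then have "{real q * real Q<..real q * real Q + 1/2}
      = {real (q * c) * real P<..real (q * c) * real P + 1/2}" for q by (simp add: mult_ac)
  then show ?thesis unfolding bursts_def by blast
qed

lemma bursts_sets [measurable]: "bursts P \<in> sets lebesgue"
  unfolding bursts_def by (intro sets.countable_UN) auto

text \<open>
  Outside the bursts their total duration depends only on the number of periods begun; this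
  is why the position of a runner is known exactly, up to drift, while it covers.
\<close>

lemma measure_bursts:
  assumes "real q * real P + 1/2 \<le> s" "s \<le> (real q + 1) * real P"
  shows "measure lebesgue (bursts P \<inter> {0<..s}) = (real q + 1) / 2"
proof -
  define I where "I r = {real r * real P<..real r * real P + 1/2}" for r
  have P: "P \<ge> 1"
    using assms by (cases P) auto
  have sep: "real r * real P + real P \<le> real r' * real P" if "r < r'" for r r'
  proof -
    have "(r + 1) * P \<le> r' * P" using that by (intro mult_right_mono) auto
    then have "real ((r + 1) * P) \<le> real (r' * P)" by (simp only: of_nat_le_iff)
    then show ?thesis by (simp add: algebra_simps)
  qed
  have "bursts P \<inter> {0<..s} = (\<Union>r\<in>{..q}. I r)"
  proof (intro equalityI subsetI)
    fix x assume "x \<in> bursts P \<inter> {0<..s}"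
    then obtain r where r: "x \<in> I r" "x \<le> s" by (auto simp: bursts_def I_def)
    have "r \<le> q"
    proof (rule ccontr)
      assume "\<not> r \<le> q"
      then have "real q * real P + real P \<le> real r * real P" by (intro sep) auto
      with r assms(2) show False by (auto simp: I_def algebra_simps)
    qed
    with r show "x \<in> (\<Union>r\<in>{..q}. I r)" by auto
  next
    fix x assume "x \<in> (\<Union>r\<in>{..q}. I r)"
    then obtain r where r: "r \<le> q" "x \<in> I r" by auto
    have "real r * real P \<le> real q * real P" using r by (intro mult_right_mono) auto
    moreover have "0 \<le> real r * real P" by simp
    ultimately have "0 < x" "x \<le> s" using r assms(1) unfolding I_def greaterThanAtMost_iff by linarith+
    with r show "x \<in> bursts P \<inter> {0<..s}" by (auto simp: bursts_def I_def)
  qed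
  also have "measure lebesgue \<dots> = (\<Sum>r\<le>q. measure lebesgue (I r))"
  proof (rule measure_finite_Union)
    have "I r \<inter> I r' = {}" if "r < r'" for r r'
      using sep[OF that] P by (auto simp: I_def)
    then show "disjoint_family_on I {..q}"
      unfolding disjoint_family_on_def by (metis inf_commute linorder_neqE_nat)
  qed (auto simp: I_def)
  also have "\<dots> = (real q + 1) / 2"
    by (simp add: I_def)
  finally show ?thesis .
qed

text \<open>
  The velocities relative to runner \<open>1\<close> are of this form: a constant speed, the periodic bursts
  and one additional rush at the beginning.
\<close>

lemma affine_indicator_integral:
  fixes a b c s :: real
  assumes [measurable]: "A \<in> sets lebesgue" "B \<in> sets lebesgue" and "s > 0"
  shows "set_integrable lebesgue {0<..s} (\<lambda>t. a + b * indicator A t + c * indicator B t)"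
    and "(LINT t:{0<..s}|lebesgue. a + b * indicator A t + c * indicator B t)
           = a * s + b * measure lebesgue (A \<inter> {0<..s}) + c * measure lebesgue (B \<inter> {0<..s})"
proof -
  have fin: "emeasure lebesgue (X \<inter> {0<..s}) < \<infinity>" if [measurable]: "X \<in> sets lebesgue" for X
    using emeasure_mono[of "X \<inter> {0<..s}" "{0<..s}" lebesgue] \<open>s > 0\<close>
    by (auto simp: less_top[symmetric] top_unique)
  have eq: "(\<lambda>t. indicator {0<..s} t *\<^sub>R (a + b * indicator A t + c * indicator B t))
    = (\<lambda>t. a * indicator (UNIV \<inter> {0<..s}) t + b * indicator (A \<inter> {0<..s}) t
          + c * indicator (B \<inter> {0<..s}) t)"
    by (auto simp: fun_eq_iff indicator_def)
  have ind: "has_bochner_integral lebesgue (\<lambda>t. d * indicator (X \<inter> {0<..s}) t :: real)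
    (d * measure lebesgue (X \<inter> {0<..s}))" if "X \<in> sets lebesgue" for X d
    using fin[OF that] that
    by (intro has_bochner_integral_mult_right has_bochner_integral_real_indicator) auto
  have *: "has_bochner_integral lebesgue
    (\<lambda>t. indicator {0<..s} t *\<^sub>R (a + b * indicator A t + c * indicator B t))
    (a * measure lebesgue (UNIV \<inter> {0<..s}) + b * measure lebesgue (A \<inter> {0<..s})
       + c * measure lebesgue (B \<inter> {0<..s}))"
    unfolding eq by (intro has_bochner_integral_add ind) auto
  show "set_integrable lebesgue {0<..s} (\<lambda>t. a + b * indicator A t + c * indicator B t)"
    using * unfolding set_integrable_def by (simp add: has_bochner_integral_iff)
  show "(LINT t:{0<..s}|lebesgue. a + b * indicator A t + c * indicator B t)
           = a * s + b * measure lebesgue (A \<inter> {0<..s}) + c * measure lebesgue (B \<inter> {0<..s})"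
    using * \<open>s > 0\<close> unfolding set_lebesgue_integral_def by (simp add: has_bochner_integral_iff)
qed

section \<open>The velocities\<close>

definition period :: "nat \<Rightarrow> nat \<Rightarrow> nat" where
  "period n i = 2 ^ (n + 1 - i)"

text \<open>
  The extra gain per period, beyond the common speed. Modulo \<open>1\<close> it cancels the
  common motion over one period; the summand \<open>i\<close> is the integer that makes it increase with
  \<open>i\<close>, and \<open>P/K = 2\<close> for \<open>i = 2\<close>, so that runner \<open>2\<close> gains nothing.
\<close>

definition jump :: "nat \<Rightarrow> nat \<Rightarrow> real" where
  "jump n i = real i - real (period n i) / 2 ^ (n - 2)"

text \<open>
  The additional gain at the beginning. The first slot of runner \<open>i \<ge> 3\<close> is at half a period, after
  one full gain but only half the common motion of a period; this restores the missing half
  modulo \<open>1\<close>. The integer \<open>i - 3\<close> makes the value \<open>0\<close> for \<open>i = 2\<close> and monotone in \<open>i\<close>.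
\<close>

definition start :: "nat \<Rightarrow> nat \<Rightarrow> real" where
  "start n i = real i - 3 + real (period n i) / (2 * 2 ^ (n - 2))"

text \<open>
  The velocity relative to runner \<open>1\<close>. Of each gain, the fraction \<open>a\<close> is drift and \<open>1 - a\<close> is made in
  the burst; the factors \<open>2\<close> come from the burst length \<open>1/2\<close>.
\<close>

definition velocity :: "nat \<Rightarrow> real \<Rightarrow> nat \<Rightarrow> real \<Rightarrow> real" where
  "velocity n a i t = (if i \<le> 1 then 0 else
     (1 / 2 ^ (n - 2) + jump n i * a / period n i)
     + 2 * (1 - a) * jump n i * indicator (bursts (period n i)) t
     + 2 * start n i * indicator {0<..1/2} t)"

lemma period_second:
  assumes "n \<ge> 2"
  shows "real (period n 2) = 2 * 2 ^ (n - 2)"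
proof -
  have "n + 1 - 2 = Suc (n - 2)" using assms by simp
  then show ?thesis unfolding period_def by (simp only: power_Suc) simp
qed

lemma jump_second: "n \<ge> 2 \<Longrightarrow> jump n 2 = 0"
  and start_second: "n \<ge> 2 \<Longrightarrow> start n 2 = 0"
  by (simp_all add: jump_def start_def period_second)

lemma period_dvd: "i \<le> j \<Longrightarrow> period n j dvd period n i"
  unfolding period_def by (intro le_imp_power_dvd) auto

lemma period_pos [simp]: "period n i > 0"
  by (simp add: period_def)

lemma period_mono: "i \<le> j \<Longrightarrow> period n j \<le> period n i"
  unfolding period_def by (intro power_increasing) auto

lemma jump_strict_mono:
  assumes "i < j"
  shows "jump n i < jump n j"
proof -
  have "real (period n j) / 2 ^ (n - 2) \<le> real (period n i) / 2 ^ (n - 2)"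
    using period_mono[of i j n] assms by (intro divide_right_mono) auto
  with assms show ?thesis unfolding jump_def by linarith
qed

lemma start_mono:
  assumes "n \<ge> 2" "2 \<le> i" "i < j"
  shows "start n i \<le> start n j"
proof -
  have "real (period n i) / (2 * 2 ^ (n - 2)) \<le> 1"
    using period_mono[of 2 i n] assms by (simp flip: period_second)
  moreover have "real (period n j) / (2 * 2 ^ (n - 2)) \<ge> 0" by simp
  ultimately show ?thesis using assms(3) unfolding start_def by linarith
qed

lemma jump_nonneg: "n \<ge> 2 \<Longrightarrow> 2 \<le> i \<Longrightarrow> jump n i \<ge> 0"
  using jump_second[of n] jump_strict_mono[of 2 i n] by (cases "i = 2") auto

lemma start_nonneg: "n \<ge> 2 \<Longrightarrow> 2 \<le> i \<Longrightarrow> start n i \<ge> 0"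
  using start_second[of n] start_mono[of n 2 i] by (cases "i = 2") auto

text \<open>
  The three contributions are compared separately. For the bursts this uses that the slower
  runner's bursts are among the faster one's; the strict gap comes from the drift, and, against
  runner \<open>1\<close>, from the common speed.
\<close>

lemma velocity_gap:
  assumes "n \<ge> 2" "0 < a" "a < 1" "1 \<le> i" "i < j"
  shows "\<exists>c>0. \<forall>t. velocity n a i t + c \<le> velocity n a j t"
proof (cases "i = 1")
  case True
  have "1 / 2 ^ (n - 2) \<le> velocity n a j t" for t
    using assms jump_nonneg[of n j] start_nonneg[of n j]
    by (auto simp: velocity_def indicator_def)
  then show ?thesis using True by (intro exI[of _ "1 / 2 ^ (n - 2)"]) (auto simp: velocity_def)
next
  case False
  then have i: "2 \<le> i" using assms by simp
  define c where "c = (jump n j - jump n i) * a / period n j"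
  have "c > 0" using jump_strict_mono[OF assms(5), of n] assms by (simp add: c_def)
  moreover have "velocity n a i t + c \<le> velocity n a j t" for t
  proof -
    have "jump n i * a / period n i \<le> jump n i * a / period n j"
      using jump_nonneg[OF assms(1) i] assms period_mono[of i j n]
      by (intro divide_left_mono mult_nonneg_nonneg mult_pos_pos) auto
    then have slow: "jump n i * a / period n i + c \<le> jump n j * a / period n j"
      unfolding c_def by (simp add: diff_divide_distrib algebra_simps)
    have "indicator (bursts (period n i)) t \<le> (indicator (bursts (period n j)) t :: real)"
      using bursts_antimono[OF period_dvd[of i j n]] assms by (auto simp: indicator_def)
    then have fast: "2 * (1 - a) * jump n i * indicator (bursts (period n i)) t
        \<le> 2 * (1 - a) * jump n j * indicator (bursts (period n j)) t"
      using jump_strict_mono[OF assms(5), of n] jump_nonneg[OF assms(1) i] assms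
      by (intro mult_mono) auto
    have first: "2 * start n i * indicator {0<..1/2} t \<le> 2 * start n j * indicator {0<..1/2} t"
      using start_mono[OF assms(1) i assms(5)] by (auto simp: indicator_def)
    have "\<not> i \<le> 1" "\<not> j \<le> 1" using i assms(5) by auto
    then show ?thesis using slow fast first unfolding velocity_def by (simp only: if_False)
  qed
  ultimately show ?thesis by blast
qed

lemma velocity_integrable:
  assumes "s > 0"
  shows "set_integrable lebesgue {0<..s} (velocity n a i)"
proof (cases "i \<le> 1")
  case True
  then have "velocity n a i = (\<lambda>t. 0)" by (auto simp: velocity_def)
  then show ?thesis by (simp add: set_integrable_def)
next
  case False
  then have "velocity n a i = (\<lambda>t. (1 / 2 ^ (n - 2) + jump n i * a / period n i)
     + 2 * (1 - a) * jump n i * indicator (bursts (period n i)) t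
     + 2 * start n i * indicator {0<..1/2} t)" by (auto simp: velocity_def)
  moreover have "{0<..1/2 :: real} \<in> sets lebesgue" by simp
  ultimately show ?thesis
    by (simp only: affine_indicator_integral(1)[OF bursts_sets _ assms])
qed

section \<open>Innocence\<close>

lemma displacement_tendsto_at_top:
  assumes "c > 0" "\<And>t. v t + c \<le> w t" "velocity_function v" "velocity_function w"
  shows "filterlim (rel_displacement v w) at_top at_top"
proof (rule filterlim_at_top_mono)
  show "filterlim (\<lambda>s. c * s) at_top at_top"
    using assms(1) by (intro filterlim_tendsto_pos_mult_at_top[OF tendsto_const] filterlim_ident) auto
  have "c * s \<le> rel_displacement v w s" if "s > 0" for s
  proof -
    have "(LINT t:{0<..s}|lebesgue. c) \<le> (LINT t:{0<..s}|lebesgue. w t - v t)"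
    proof (rule set_integral_mono)
      show "set_integrable lebesgue {0<..s} (\<lambda>t. c)"
        using affine_indicator_integral(1)[of "{}" "{}" s c 0 0] that by simp
      show "set_integrable lebesgue {0<..s} (\<lambda>t. w t - v t)"
        using assms that by (intro set_integral_diff) (auto simp: velocity_function_def)
    qed (use assms(2) in \<open>simp add: algebra_simps\<close>)
    then show ?thesis
      using affine_indicator_integral(2)[of "{}" "{}" s c 0 0] that by (simp add: rel_displacement_def)
  qed
  then show "\<forall>\<^sub>F s in at_top. c * s \<le> rel_displacement v w s"
    by (rule eventually_mono[OF eventually_gt_at_top])
qed

lemma innocent_velocity:
  assumes "n \<ge> 2" "0 < a" "a < 1"
  shows "innocent_runners n (velocity n a)"
proof -
  have vf: "velocity_function (velocity n a i)" for i
    by (simp add: velocity_function_def velocity_integrable)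
  have "velocity n a i t < velocity n a j t" if "1 \<le> i" "i < j" for i j t
  proof -
    obtain c where "c > 0" "velocity n a i t + c \<le> velocity n a j t"
      using velocity_gap[OF assms \<open>1 \<le> i\<close> \<open>i < j\<close>] by blast
    then show ?thesis by linarith
  qed
  then have mono: "strict_mono_on {1..n} (\<lambda>i. velocity n a i t)" for t
    by (intro strict_mono_onI) simp
  have lim: "filterlim (rel_displacement (velocity n a i) (velocity n a j)) at_top at_top"
    if "1 \<le> i" "i < j" for i j
  proof -
    obtain c where "c > 0" "\<And>t. velocity n a i t + c \<le> velocity n a j t"
      using velocity_gap[OF assms \<open>1 \<le> i\<close> \<open>i < j\<close>] by blast
    then show ?thesis using vf vf by (rule displacement_tendsto_at_top)
  qed
  show ?thesis
    unfolding innocent_runners_def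
  proof (intro conjI ballI impI)
    show "AE t\<in>{0<..} in lebesgue. strict_mono_on {1..n} (\<lambda>i. velocity n a i t)"
      using mono by (intro AE_I2 impI)
  qed (use vf lim in simp_all)
qed

section \<open>Covering the slots\<close>

lemma displacement_first:
  assumes "s > 0" "2 \<le> i"
  shows "rel_displacement (velocity n a 1) (velocity n a i) s =
     (1 / 2 ^ (n - 2) + jump n i * a / period n i) * s
     + 2 * (1 - a) * jump n i * measure lebesgue (bursts (period n i) \<inter> {0<..s})
     + 2 * start n i * measure lebesgue ({0<..1/2} \<inter> {0<..s})"
proof -
  have half_sets: "{0<..1/2 :: real} \<in> sets lebesgue" by simp
  have "velocity n a i t - velocity n a 1 t = (1 / 2 ^ (n - 2) + jump n i * a / period n i)
     + 2 * (1 - a) * jump n i * indicator (bursts (period n i)) t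
     + 2 * start n i * indicator {0<..1/2} t" for t
    using assms(2) by (simp add: velocity_def)
  then show ?thesis
    unfolding rel_displacement_def
    by (simp only: affine_indicator_integral(2)[OF bursts_sets half_sets assms(1)])
qed

lemma norm_RZ_add_int_le: "norm_RZ (of_int z + y) \<le> \<bar>y\<bar>"
  unfolding norm_RZ_def by (rule infdist_le2[of "of_int z"]) (auto simp: dist_real_def)

text \<open>
  The ruler sequence: \<open>v\<close> is the exponent of \<open>2\<close> in \<open>k\<close>, and the first alternative collects all
  exponents from \<open>N\<close> on.
\<close>

lemma dvd_power_two_or_odd_multiple:
  fixes k :: nat
  shows "2 ^ N dvd k \<or> (\<exists>v<N. \<exists>q. k = 2 ^ v * (2 * q + 1))"
proof (induction N)
  case (Suc N)
  then consider q where "k = 2 ^ N * q" | v q where "v < N" "k = 2 ^ v * (2 * q + 1)"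
    unfolding dvd_def by blast
  then show ?case
  proof cases
    case (1 q)
    show ?thesis
    proof (cases "even q")
      case True
      with 1 show ?thesis by (auto simp: mult_ac)
    next
      case False
      then obtain p where "q = 2 * p + 1" by (rule oddE)
      with 1 show ?thesis by blast
    qed
  next
    case (2 v q)
    then have "v < Suc N" by simp
    with 2 show ?thesis by blast
  qed
qed simp

text \<open>Runner \<open>2\<close> just moves at the common speed, so it covers every multiple of \<open>K\<close>.\<close>

lemma runner_two_close:
  assumes "n \<ge> 2" "s > 0" "2 ^ (n - 2) dvd k" "\<bar>s - real k\<bar> \<le> 1/2"
  shows "norm_RZ (rel_displacement (velocity n a 1) (velocity n a 2) s) \<le> 1 / 2 ^ (n - 1)"
proof -
  obtain q where q: "k = 2 ^ (n - 2) * q" using assms(3) by blast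
  have n1: "(2::real) ^ (n - 1) = 2 * 2 ^ (n - 2)"
    using assms(1) by (metis Suc_diff_Suc Suc_1 Suc_le_lessD power_Suc)
  have "rel_displacement (velocity n a 1) (velocity n a 2) s = s / 2 ^ (n - 2)"
    using displacement_first[OF assms(2), of 2 n a] assms(1)
    by (simp add: jump_second start_second)
  also have "\<dots> = of_int (int q) + (s - real k) / 2 ^ (n - 2)"
    by (simp add: q field_simps)
  finally have "norm_RZ (rel_displacement (velocity n a 1) (velocity n a 2) s)
      \<le> \<bar>(s - real k) / 2 ^ (n - 2)\<bar>"
    using norm_RZ_add_int_le by presburger
  also have "\<dots> \<le> (1/2) / 2 ^ (n - 2)"
    using divide_right_mono[OF assms(4), of "2 ^ (n - 2)"] by (simp add: abs_divide)
  finally show ?thesis unfolding n1 by simp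
qed

text \<open>
  Runner \<open>n - v\<close> has period \<open>P = 2^(v+1)\<close>, so slot \<open>k\<close> lies in the middle of its period number \<open>q\<close>,
  after exactly \<open>q + 1\<close> bursts. At time \<open>k\<close> the common motion \<open>k/K\<close>, the \<open>q + 1\<close> gains and the initial
  gain add up to an integer, except that part of the last drift is still missing.
\<close>

lemma runner_close:
  assumes "0 < a" "a < 1" "s > 0" "v < n - 2" "k = 2 ^ v * (2 * q + 1)"
    "\<bar>s - real k\<bar> \<le> 1/2"
  shows "norm_RZ (rel_displacement (velocity n a 1) (velocity n a (n - v)) s) \<le> 1 / 2 ^ (n - 1) + a * n"
proof -
  define i where "i = n - v"
  define P where "P = real (period n i)"
  define K where "K = (2::real) ^ (n - 2)"
  define D where "D = jump n i"
  have i: "3 \<le> i" "i \<le> n" and n: "n \<ge> 2" using assms(4) by (auto simp: i_def)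
  have "n + 1 - i = Suc v" using assms(4) by (auto simp: i_def)
  then have P: "P = 2 * 2 ^ v" by (simp add: P_def period_def)
  have K: "K > 0" by (simp add: K_def)
  have n1: "(2::real) ^ (n - 1) = 2 * K"
    using n unfolding K_def by (metis Suc_diff_Suc Suc_1 Suc_le_lessD power_Suc)
  have k: "real k = real q * P + P / 2" by (simp add: assms(5) P algebra_simps)
  have P2: "P \<ge> 2" by (simp add: P)
  have lo: "real q * P + 1/2 \<le> s" and hi: "s \<le> (real q + 1) * P"
    using assms(6) P2 unfolding k distrib_right by linarith+
  have "0 \<le> real q * P" using P2 by simp
  then have "{0<..1/2} \<inter> {0<..s} = {0<..1/2}" using lo by auto
  then have half: "measure lebesgue ({0<..1/2} \<inter> {0<..s}) = 1/2" by simp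
  \<comment> \<open>the fraction of the current period's gain that the drift has yet to deliver\<close>
  define \<theta> where "\<theta> = a * (real q + 1 - s / P)"
  have "s / P \<le> real q + 1" "real q \<le> s / P" using lo hi P2 by (auto simp: field_simps)
  then have \<theta>: "0 \<le> \<theta>" "\<theta> \<le> a" using assms(1) by (auto simp: \<theta>_def mult_le_cancel_left1)
  have D: "0 \<le> D" "D \<le> n"
  proof -
    show "0 \<le> D" using jump_nonneg[of n i] n i by (simp add: D_def)
    have "D = real i - P / K" by (simp add: D_def jump_def P_def K_def)
    moreover have "P / K \<ge> 0" using P2 K by simp
    moreover have "real i \<le> real n" using i by simp
    ultimately show "D \<le> n" by linarith
  qed
  have bursts: "measure lebesgue (bursts (period n i) \<inter> {0<..s}) = (real q + 1) / 2"
    using measure_bursts lo hi unfolding P_def by blast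
  have "2 \<le> i" using i by simp
  have "rel_displacement (velocity n a 1) (velocity n a i) s
      = (1 / K + D * a / P) * s + 2 * (1 - a) * D * ((real q + 1) / 2) + start n i"
    unfolding displacement_first[OF assms(3) \<open>2 \<le> i\<close>] bursts half P_def K_def D_def by simp
  also have "\<dots> = s / K + D * (real q + 1) + start n i - D * \<theta>"
    by (simp add: \<theta>_def algebra_simps add_divide_distrib)
  also have "\<dots> = of_int (int i * (int q + 1) + int i - 3) + ((s - real k) / K - D * \<theta>)"
  proof -
    \<comment> \<open>in terms of \<open>P / K\<close> the identity is polynomial, and all its multiples cancel\<close>
    define \<rho> where "\<rho> = P / K"
    have k': "real k / K = real q * \<rho> + \<rho> / 2" by (simp add: k \<rho>_def add_divide_distrib)
    have D': "D = real i - \<rho>" by (simp add: D_def jump_def P_def K_def \<rho>_def)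
    have start': "start n i = real i - 3 + \<rho> / 2"
      by (simp add: start_def P_def K_def \<rho>_def)
    show ?thesis unfolding diff_divide_distrib k' D' start' by (simp add: algebra_simps)
  qed
  finally have "norm_RZ (rel_displacement (velocity n a 1) (velocity n a i) s) \<le> \<bar>(s - real k) / K - D * \<theta>\<bar>"
    using norm_RZ_add_int_le by presburger
  also have "\<dots> \<le> \<bar>s - real k\<bar> / K + D * \<theta>"
    using abs_triangle_ineq4[of "(s - real k) / K" "D * \<theta>"] K D \<theta> by (simp add: abs_divide abs_mult)
  also have "\<dots> \<le> (1/2) / K + n * a"
    using K D \<theta> assms by (intro add_mono divide_right_mono mult_mono) auto
  finally show ?thesis unfolding n1 i_def by (simp add: mult.commute)
qed

theorem theorem1p4:
  fixes n :: nat and \<epsilon> :: real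
  assumes "n \<ge> 2" and "\<epsilon> > 0"
  shows "\<exists>\<nu> :: nat \<Rightarrow> real \<Rightarrow> real. innocent_runners n \<nu> \<and>
           (\<forall>s>0. \<exists>j\<in>{2..n}.
              norm_RZ (rel_displacement (\<nu> 1) (\<nu> j) s) < 2 powi (- int n + 1) + \<epsilon>)"
proof -
  \<comment> \<open>the denominator \<open>n + 1\<close> instead of \<open>n\<close> makes \<open>a * n\<close> strictly smaller than \<open>\<epsilon>\<close>\<close>
  define a where "a = min (1/2) (\<epsilon> / (real n + 1))"
  have a: "0 < a" "a < 1" using assms by (auto simp: a_def)
  have "a \<le> \<epsilon> / (real n + 1)" by (simp add: a_def)
  then have "a * (real n + 1) \<le> \<epsilon>" by (subst (asm) pos_le_divide_eq) auto
  with a have an: "a * n < \<epsilon>" by (simp add: algebra_simps)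
  have "- int n + 1 = - int (n - 1)" using assms(1) by simp
  then have bound: "2 powi (- int n + 1) = 1 / (2::real) ^ (n - 1)"
    by (simp only: power_int_minus power_int_of_nat inverse_eq_divide)
  have "\<exists>j\<in>{2..n}. norm_RZ (rel_displacement (velocity n a 1) (velocity n a j) s)
           < 2 powi (- int n + 1) + \<epsilon>" if s: "s > 0" for s
  proof -
    define k where "k = nat (round s)"
    have "round s \<ge> 0" using s by (simp add: round_def)
    then have k: "\<bar>s - real k\<bar> \<le> 1/2"
      using of_int_round_abs_le[of s] by (simp add: k_def abs_minus_commute)
    consider "2 ^ (n - 2) dvd k" | v q where "v < n - 2" "k = 2 ^ v * (2 * q + 1)"
      using dvd_power_two_or_odd_multiple[of "n - 2" k] by blast
    then show ?thesis
    proof cases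
      case 1
      then show ?thesis
        using runner_two_close[OF assms(1) s 1 k, of a] assms bound by (intro bexI[of _ 2]) auto
    next
      case (2 v q)
      then show ?thesis
        using runner_close[OF a s 2 k] an bound by (intro bexI[of _ "n - v"]) auto
    qed
  qed
  with innocent_velocity[OF assms(1) a] show ?thesis by blast
qed

end
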